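(* Let $\Omega$, $\{\mathcal T_h\}_{h>0}$, $\mathcal N_h$, $X_h$, $Q_h$, $\boldsymbol U_h$, $i_{Q_h}$, $(\cdot,\cdot)_h$, $\|\cdot\|_h$, $\gamma>0$, $\alpha\ge 0$ be as in the context, and let $\boldsymbol u_0\in \boldsymbol H^1(\Omega)$ with $|\boldsymbol u_0|=1$ a.e. in $\Omega$ and $\boldsymbol u_{0h}\in\boldsymbol U_h$ with $|\boldsymbol u_{0h}(\boldsymbol a)|=1$ for all $\boldsymbol a\in\mathcal N_h$ and $\|\nabla \boldsymbol u_{0h}\|\le\|\nabla\boldsymbol u_0\|$. Let $(\boldsymbol u_h,q_h)\in C^\infty([0,+\infty);\boldsymbol U_h)\times C^\infty([0,+\infty);Q_h)$ satisfy $\boldsymbol u_h(0)=\boldsymbol u_{0h}$ and, for all $t\ge 0$ and all $(\bar{\boldsymbol u}_h,\bar q_h)\in\boldsymbol U_h\times Q_h$, $$(\partial_t\boldsymbol u_h,\bar{\boldsymbol u}_h)_h+\gamma(\nabla\boldsymbol u_h,\nabla\bar{\boldsymbol u}_h)+\gamma(q_h,i_{Q_h}(\boldsymbol u_h\cdot\bar{\boldsymbol u}_h))+\alpha(\boldsymbol u_h\times\partial_t\boldsymbol u_h,\bar{\boldsymbol u}_h)_h=0,$$ $$(i_{Q_h}(\boldsymbol u_h\cdot\boldsymbol u_h),\bar q_h)=(1,\bar q_h).$$ Then, for all $t\ge0$, $|\boldsymbol u_h(\boldsymbol a,t)|=1$ for all $\boldsymbol a\in\mathcal N_h$, and $$\int_0^t\|\partial_t\boldsymbol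 u_h(s)\|_h^2\,ds+\frac{\gamma}{2}\|\nabla\boldsymbol u_h(t)\|^2=\frac{\gamma}{2}\|\nabla\boldsymbol u_{0h}\|^2 .$$
   Context: $M\in\{2,3\}$; $\Omega\subset\mathbb R^M$ is a bounded domain with polygonal/polyhedral Lipschitz boundary; $\{\mathcal T_h\}_{h>0}$ is a shape-regular, quasi-uniform family of conforming triangulations of $\overline\Omega$ into triangles ($M=2$) or tetrahedra ($M=3$), $h=\max_{K\in\mathcal T_h}\operatorname{diam}K$; $\mathcal N_h$ is the set of all nodes (vertices) of $\mathcal T_h$. $X_h=\{v_h\in C^0(\overline\Omega): v_h|_K \text{ is a polynomial of degree}\le 1\ \forall K\in\mathcal T_h\}$ with nodal (Lagrange) basis $\{\varphi_{\boldsymbol a}\}_{\boldsymbol a\in\mathcal N_h}$; $Q_h=X_h$, $\boldsymbol U_h=(X_h)^M$. $i_{Q_h}:C^0(\overline\Omega)\to Q_h$ is nodal interpolation, $i_{Q_h}(f)=\sum_{\boldsymbol a}f(\boldsymbol a)\varphi_{\boldsymbol a}$. $(\cdot,\cdot)$ and $\|\cdot\|$ are the $L^2(\Omega)$ inner product and norm (for scalars, vectors, matrices). The lumped product is $(\boldsymbol v,\boldsymbol w)_h=\int_\Omega i_{Q_h}(\boldsymbol v\cdot\boldsymbol w)=\sum_{\boldsymbol a\in\mathcal N_h}\boldsymbol v(\boldsymbol a)\cdot\boldsymbol w(\boldsymbol a)\int_\Omega\varphi_{\boldsymbol a}$, with norm $\|\boldsymbol v\|_h=\sqrt{(\boldsymbol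 v,\boldsymbol v)_h}$. $\gamma>0$ and $\alpha\ge0$ are real constants; if $M=2$ then $\alpha=0$ (the cross-product term is absent). *)

theory Defs
  imports "HOL-Analysis.Analysis"
begin

section \<open>Domains and meshes\<close>

text \<open>Near every boundary point the set is, for a suitable direction \<open>\<nu>\<close>, the strict hypograph
  over the hyperplane orthogonal to \<open>\<nu>\<close> of a Lipschitz function \<open>g\<close>; the vector
  \<open>y - (y \<bullet> \<nu>) *\<^sub>R \<nu>\<close> is the orthogonal projection of \<open>y\<close> onto that hyperplane.\<close>

definition lipschitz_boundary :: "'a::euclidean_space set \<Rightarrow> bool" where
  "lipschitz_boundary \<Omega> \<longleftrightarrow>
     (\<forall>x\<in>frontier \<Omega>. \<exists>U \<nu> L g. open U \<and> x \<in> U \<and> norm \<nu> = 1 \<and>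
        L-lipschitz_on {z. z \<bullet> \<nu> = 0} (g :: 'a \<Rightarrow> real) \<and>
        \<Omega> \<inter> U = {y \<in> U. y \<bullet> \<nu> < g (y - (y \<bullet> \<nu>) *\<^sub>R \<nu>)})"

definition polytopal_boundary :: "'a::euclidean_space set \<Rightarrow> bool" where
  "polytopal_boundary \<Omega> \<longleftrightarrow>
     (\<exists>F. finite F \<and> (\<forall>f\<in>F. polytope f \<and> aff_dim f = int DIM('a) - 1) \<and> frontier \<Omega> = \<Union>F)"

definition lipschitz_polytopal_domain :: "'a::euclidean_space set \<Rightarrow> bool" where
  "lipschitz_polytopal_domain \<Omega> \<longleftrightarrow>
     open \<Omega> \<and> connected \<Omega> \<and> \<Omega> \<noteq> {} \<and> bounded \<Omega> \<and> lipschitz_boundary \<Omega> \<and> polytopal_boundary \<Omega>"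

text \<open>Conformity (any two cells meet in a common, possibly empty, face) is part of
  \<^const>\<open>triangulation\<close>.\<close>

definition mesh_of :: "'a::euclidean_space set \<Rightarrow> 'a set set \<Rightarrow> bool" where
  "mesh_of \<Omega> T \<longleftrightarrow>
     triangulation T \<and> (\<forall>K\<in>T. int DIM('a) simplex K) \<and> \<Union>T = closure \<Omega>"

definition mesh_size :: "'a::euclidean_space set set \<Rightarrow> real" where
  "mesh_size T = Max (diameter ` T)"

definition inball_diameter :: "'a::euclidean_space set \<Rightarrow> real" where
  "inball_diameter K = Sup {2 * r |r x. 0 \<le> r \<and> cball x r \<subseteq> K}"

text \<open>The set \<open>H\<close> collects the mesh sizes that occur in the family. It cannot be all of the
  positive reals, since no mesh of a bounded domain has cells larger than the domain.\<close>

definition regular_mesh_family ::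
    "'a::euclidean_space set \<Rightarrow> real set \<Rightarrow> (real \<Rightarrow> 'a set set) \<Rightarrow> bool" where
  "regular_mesh_family \<Omega> H \<T> \<longleftrightarrow>
     H \<subseteq> {0<..} \<and>
     (\<forall>h\<in>H. mesh_of \<Omega> (\<T> h) \<and> h = mesh_size (\<T> h)) \<and>
     (\<exists>\<sigma>. \<forall>h\<in>H. \<forall>K\<in>\<T> h. diameter K \<le> \<sigma> * inball_diameter K) \<and>
     (\<exists>c>0. \<forall>h\<in>H. \<forall>K\<in>\<T> h. c * h \<le> diameter K)"

definition nodes :: "'a::euclidean_space set set \<Rightarrow> 'a set" where
  "nodes T = {a. \<exists>K\<in>T. a extreme_point_of K}"


section \<open>Finite element spaces\<close>

text \<open>Functions on \<open>closure \<Omega>\<close> are represented by total functions; in the discrete spaces the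
  representative vanishes outside \<open>closure \<Omega>\<close>, so that equality of representatives is equality of
  functions on \<open>closure \<Omega>\<close>.\<close>

definition P1 :: "'a::euclidean_space set \<Rightarrow> 'a set set \<Rightarrow> ('a \<Rightarrow> real) set" where
  "P1 \<Omega> T = {v. continuous_on (closure \<Omega>) v \<and>
                (\<forall>K\<in>T. \<exists>p c. \<forall>x\<in>K. v x = p \<bullet> x + c) \<and>
                (\<forall>x. x \<notin> closure \<Omega> \<longrightarrow> v x = 0)}"

definition P1_vec ::
    "(real^'n) set \<Rightarrow> (real^'n) set set \<Rightarrow> (real^'n \<Rightarrow> real^'n) set" where
  "P1_vec \<Omega> T = {v. \<forall>i. (\<lambda>x. v x $ i) \<in> P1 \<Omega> T}"

definition nodal_basis :: "'a::euclidean_space set \<Rightarrow> 'a set set \<Rightarrow> 'a \<Rightarrow> ('a \<Rightarrow> real)" where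
  "nodal_basis \<Omega> T a =
     (THE \<phi>. \<phi> \<in> P1 \<Omega> T \<and> (\<forall>b\<in>nodes T. \<phi> b = (if b = a then 1 else 0)))"

definition nodal_interp ::
    "'a::euclidean_space set \<Rightarrow> 'a set set \<Rightarrow> ('a \<Rightarrow> real) \<Rightarrow> ('a \<Rightarrow> real)" where
  "nodal_interp \<Omega> T f = (\<lambda>x. \<Sum>a\<in>nodes T. f a * nodal_basis \<Omega> T a x)"


section \<open>Inner products and norms\<close>

text \<open>The value type covers scalars, vectors and matrices; on matrices the inner product of the
  type \<^typ>\<open>real^'n^'n\<close> is the Frobenius product.\<close>

definition L2_inner ::
    "'a::euclidean_space set \<Rightarrow> ('a \<Rightarrow> 'b::euclidean_space) \<Rightarrow> ('a \<Rightarrow> 'b) \<Rightarrow> real" where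
  "L2_inner \<Omega> f g = (LINT x|lebesgue_on \<Omega>. f x \<bullet> g x)"

definition L2_norm ::
    "'a::euclidean_space set \<Rightarrow> ('a \<Rightarrow> 'b::euclidean_space) \<Rightarrow> real" where
  "L2_norm \<Omega> f = sqrt (L2_inner \<Omega> f f)"

definition lumped_inner ::
    "'a::euclidean_space set \<Rightarrow> 'a set set \<Rightarrow> ('a \<Rightarrow> 'b::euclidean_space) \<Rightarrow> ('a \<Rightarrow> 'b) \<Rightarrow> real" where
  "lumped_inner \<Omega> T v w = (LINT x|lebesgue_on \<Omega>. nodal_interp \<Omega> T (\<lambda>y. v y \<bullet> w y) x)"

definition lumped_norm ::
    "'a::euclidean_space set \<Rightarrow> 'a set set \<Rightarrow> ('a \<Rightarrow> 'b::euclidean_space) \<Rightarrow> real" where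
  "lumped_norm \<Omega> T v = sqrt (lumped_inner \<Omega> T v v)"


section \<open>Gradients\<close>

text \<open>Gradient of a discrete function: the classical one, which exists (and is constant) in the
  interior of each cell, hence almost everywhere. Its values on the mesh skeleton, a null set, are
  irrelevant. Row \<open>i\<close>, column \<open>j\<close> of the matrix is the \<open>j\<close>-th partial derivative of the
  \<open>i\<close>-th component.\<close>

definition grad :: "(real^'n \<Rightarrow> real^'n) \<Rightarrow> (real^'n \<Rightarrow> real^'n^'n)" where
  "grad v = (\<lambda>x. jacobian v (at x))"

primrec C_k :: "nat \<Rightarrow> ('a::euclidean_space \<Rightarrow> real) \<Rightarrow> bool" where
  "C_k 0 f \<longleftrightarrow> continuous_on UNIV f"
| "C_k (Suc k) f \<longleftrightarrow> (\<forall>x. f differentiable (at x)) \<and>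
     (\<forall>b\<in>Basis. C_k k (\<lambda>x. frechet_derivative f (at x) b))"

definition test_function :: "'a::euclidean_space set \<Rightarrow> ('a \<Rightarrow> real) \<Rightarrow> bool" where
  "test_function \<Omega> \<phi> \<longleftrightarrow>
     (\<forall>k. C_k k \<phi>) \<and> compact (closure {x. \<phi> x \<noteq> 0}) \<and> closure {x. \<phi> x \<noteq> 0} \<subseteq> \<Omega>"

definition L2_space :: "'a::euclidean_space set \<Rightarrow> ('a \<Rightarrow> 'b::euclidean_space) set" where
  "L2_space \<Omega> = {f. f \<in> borel_measurable (lebesgue_on \<Omega>) \<and>
                    integrable (lebesgue_on \<Omega>) (\<lambda>x. (norm (f x))\<^sup>2)}"

definition is_weak_grad ::
    "(real^'n) set \<Rightarrow> (real^'n \<Rightarrow> real^'n) \<Rightarrow> (real^'n \<Rightarrow> real^'n^'n) \<Rightarrow> bool" where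
  "is_weak_grad \<Omega> u G \<longleftrightarrow> G \<in> L2_space \<Omega> \<and>
     (\<forall>\<phi> i j. test_function \<Omega> \<phi> \<longrightarrow>
        (LINT x|lebesgue_on \<Omega>. u x $ i * frechet_derivative \<phi> (at x) (axis j 1)) =
        - (LINT x|lebesgue_on \<Omega>. G x $ i $ j * \<phi> x))"

definition H1_vec :: "(real^'n) set \<Rightarrow> (real^'n \<Rightarrow> real^'n) set" where
  "H1_vec \<Omega> = {u \<in> L2_space \<Omega>. \<exists>G. is_weak_grad \<Omega> u G}"

text \<open>Weak gradients are unique up to null sets, so the choice does not affect norms.\<close>

definition weak_grad ::
    "(real^'n) set \<Rightarrow> (real^'n \<Rightarrow> real^'n) \<Rightarrow> (real^'n \<Rightarrow> real^'n^'n)" where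
  "weak_grad \<Omega> u = (SOME G. is_weak_grad \<Omega> u G)"


section \<open>Curves in the discrete spaces\<close>

text \<open>Infinitely differentiable curves \<open>[0,\<infinity>) \<rightarrow> V\<close>, where \<open>V\<close> is a (finite-dimensional) space of
  continuous functions on the compact set \<open>S\<close> with the supremum norm: \<open>D k\<close> is the \<open>k\<close>-th
  derivative, obtained as a uniform limit on \<open>S\<close> of difference quotients (one-sided at \<open>0\<close>).\<close>

definition smooth_curve ::
    "'a set \<Rightarrow> ('a \<Rightarrow> 'b::real_normed_vector) set \<Rightarrow> (real \<Rightarrow> 'a \<Rightarrow> 'b) \<Rightarrow> bool" where
  "smooth_curve S V u \<longleftrightarrow>
     (\<exists>D :: nat \<Rightarrow> real \<Rightarrow> 'a \<Rightarrow> 'b. D 0 = u \<and>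
        (\<forall>k. \<forall>t\<ge>0. D k t \<in> V \<and>
           uniform_limit S (\<lambda>s x. (D k s x - D k t x) /\<^sub>R (s - t)) (D (Suc k) t)
             (at t within {0..})))"

definition time_deriv ::
    "(real \<Rightarrow> 'a \<Rightarrow> 'b::real_normed_vector) \<Rightarrow> (real \<Rightarrow> 'a \<Rightarrow> 'b)" where
  "time_deriv u t = (\<lambda>x. vector_derivative (\<lambda>s. u s x) (at t within {0..}))"

end

theory Submission
  imports Defs
begin

text \<open>The second equation says that the nodal interpolant of \<open>|u|\<^sup>2 - 1\<close> is \<open>L\<^sup>2\<close>-orthogonal to
  the space containing it, so it vanishes and \<open>|u| = 1\<close> at the nodes. Differentiating in time, the
  time derivative \<open>u'\<close> is pointwise orthogonal to \<open>u\<close> at the nodes. With \<open>u'\<close> as test function in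
  the first equation, the multiplier and the cross product terms therefore vanish, leaving
  \<open>\<parallel>u'\<parallel>\<^sub>h\<^sup>2\<close> plus the time derivative of the Dirichlet energy equal to zero.\<close>

section \<open>Affine functions on convex sets and simplices\<close>

text \<open>By Minkowski's theorem a compact convex set is the convex hull of its extreme points,
  and a half-space containing them contains their hull. This serves both the maximum principle on
  cells and the gluing of hat functions.\<close>

lemma affine_nonneg_from_extreme_points:
  fixes p :: "'a::euclidean_space"
  assumes "compact S" "convex S" "\<And>b. b extreme_point_of S \<Longrightarrow> 0 \<le> p \<bullet> b + c" "x \<in> S"
  shows "0 \<le> p \<bullet> x + c"
proof -
  have "convex hull {b. b extreme_point_of S} \<subseteq> {y. p \<bullet> y \<ge> - c}"
    using assms(3) by (intro hull_minimal convex_halfspace_ge) force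
  then show ?thesis
    using Krein_Milman_Minkowski[OF assms(1,2)] \<open>x \<in> S\<close> by force
qed

text \<open>Subtracting one point of \<open>C\<close> makes the remaining differences linearly
  independent, so the prescribed differences of values extend to a linear functional
  \<open>g\<close>. Its Riesz vector \<open>adjoint g 1\<close> supplies the slope.\<close>

lemma affine_independent_interpolation:
  fixes C :: "'a::euclidean_space set" and f :: "'a \<Rightarrow> real"
  assumes "\<not> affine_dependent C"
  obtains p c where "\<And>b. b \<in> C \<Longrightarrow> p \<bullet> b + c = f b"
proof (cases "C = {}")
  case False
  then obtain a where a: "a \<in> C" by blast
  let ?B = "(\<lambda>x. - a + x) ` (C - {a})"
  have "independent ?B"
    using assms affine_dependent_iff_dependent2[OF a] by simp
  then obtain g where g: "linear g" "\<forall>x\<in>?B. g x = f (a + x) - f a"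
    using linear_independent_extend[of ?B "\<lambda>x. f (a + x) - f a"] by blast
  have "adjoint g 1 \<bullet> b + (f a - adjoint g 1 \<bullet> a) = f b" if "b \<in> C" for b
  proof -
    have "adjoint g 1 \<bullet> b - adjoint g 1 \<bullet> a = g (- a + b)"
      using adjoint_works[OF g(1), of "- a + b" 1]
      by (simp add: inner_commute[of "adjoint g 1"] inner_diff_left)
    also have "\<dots> = f b - f a"
      using g that by (cases "b = a") (auto simp: linear_0)
    finally show ?thesis by simp
  qed
  then show ?thesis by (rule that)
qed (use that in blast)

section \<open>Cells, nodes and the piecewise affine space\<close>

locale mesh =
  fixes \<Omega> :: "'a::euclidean_space set" and T :: "'a set set"
  assumes mesh: "mesh_of \<Omega> T" and open_domain: "open \<Omega>"
begin

lemma finite_cells: "finite T"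
  using mesh by (simp add: mesh_of_def triangulation_def)

lemma Union_cells: "\<Union>T = closure \<Omega>"
  using mesh by (simp add: mesh_of_def)

lemma cell_simplex: "K \<in> T \<Longrightarrow> int DIM('a) simplex K"
  using mesh by (simp add: mesh_of_def)

lemma cell_compact: "K \<in> T \<Longrightarrow> compact K"
  and cell_convex: "K \<in> T \<Longrightarrow> convex K"
  and cell_polytope: "K \<in> T \<Longrightarrow> polytope K"
  using cell_simplex simplex_imp_polytope polytope_imp_compact polytope_imp_convex by blast+

lemma Int_cells_face: "K \<in> T \<Longrightarrow> L \<in> T \<Longrightarrow> (K \<inter> L) face_of K"
  using mesh by (auto simp: mesh_of_def triangulation_def)

lemma compact_closure_domain: "compact (closure \<Omega>)"
  using compact_Union[OF finite_cells] cell_compact by (auto simp: Union_cells)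

lemma domain_lmeasurable: "\<Omega> \<in> lmeasurable"
  using compact_closure_domain open_domain closure_subset
  by (meson bounded_subset compact_imp_bounded lmeasurable_open)

lemma finite_nodes: "finite (nodes T)"
proof -
  have "nodes T = (\<Union>K\<in>T. {a. a extreme_point_of K})"
    by (auto simp: nodes_def)
  then show ?thesis
    using finite_cells
    by (auto intro!: finite_polyhedron_extreme_points polytope_imp_polyhedron cell_polytope)
qed

lemma node_in_closure: "a \<in> nodes T \<Longrightarrow> a \<in> closure \<Omega>"
  unfolding Union_cells[symmetric] nodes_def by (auto simp: extreme_point_of_def)

lemma P1_continuous: "v \<in> P1 \<Omega> T \<Longrightarrow> continuous_on (closure \<Omega>) v"
  and P1_cell: "v \<in> P1 \<Omega> T \<Longrightarrow> K \<in> T \<Longrightarrow> \<exists>p c. \<forall>x\<in>K. v x = p \<bullet> x + c"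
  and P1_outside: "v \<in> P1 \<Omega> T \<Longrightarrow> x \<notin> closure \<Omega> \<Longrightarrow> v x = 0"
  by (auto simp: P1_def)

lemma P1_add:
  assumes "v \<in> P1 \<Omega> T" "w \<in> P1 \<Omega> T"
  shows "(\<lambda>x. v x + w x) \<in> P1 \<Omega> T"
proof -
  have "\<exists>p c. \<forall>x\<in>K. v x + w x = p \<bullet> x + c" if K: "K \<in> T" for K
  proof -
    obtain p c where "\<forall>x\<in>K. v x = p \<bullet> x + c"
      using P1_cell[OF assms(1) K] by blast
    moreover obtain p' c' where "\<forall>x\<in>K. w x = p' \<bullet> x + c'"
      using P1_cell[OF assms(2) K] by blast
    ultimately have "\<forall>x\<in>K. v x + w x = (p + p') \<bullet> x + (c + c')"
      by (simp add: inner_add_left)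
    then show ?thesis by blast
  qed
  then show ?thesis
    using assms by (auto simp: P1_def intro!: continuous_intros)
qed

lemma P1_scale:
  assumes "v \<in> P1 \<Omega> T"
  shows "(\<lambda>x. r * v x) \<in> P1 \<Omega> T"
proof -
  have "\<exists>p c. \<forall>x\<in>K. r * v x = p \<bullet> x + c" if K: "K \<in> T" for K
  proof -
    obtain p c where "\<forall>x\<in>K. v x = p \<bullet> x + c"
      using P1_cell[OF assms K] by blast
    then have "\<forall>x\<in>K. r * v x = (r *\<^sub>R p) \<bullet> x + r * c"
      by (simp add: algebra_simps)
    then show ?thesis by blast
  qed
  then show ?thesis
    using assms by (auto simp: P1_def intro!: continuous_intros)
qed

lemma P1_zero: "(\<lambda>x. 0) \<in> P1 \<Omega> T"
  by (auto simp: P1_def intro!: exI[of _ 0])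

lemma P1_diff:
  assumes "v \<in> P1 \<Omega> T" "w \<in> P1 \<Omega> T"
  shows "(\<lambda>x. v x - w x) \<in> P1 \<Omega> T"
  using P1_add[OF assms(1) P1_scale[OF assms(2), of "-1"]] by simp

lemma P1_sum: "(\<And>i. i \<in> I \<Longrightarrow> f i \<in> P1 \<Omega> T) \<Longrightarrow> (\<lambda>x. \<Sum>i\<in>I. f i x) \<in> P1 \<Omega> T"
  by (induction I rule: infinite_finite_induct) (auto simp: P1_zero P1_add)

lemma P1_one: "indicator (closure \<Omega>) \<in> P1 \<Omega> T"
proof -
  have "\<exists>p c. \<forall>x\<in>K. indicator (closure \<Omega>) x = p \<bullet> x + (c::real)" if "K \<in> T" for K
    using that Union_cells by (intro exI[of _ 0] exI[of _ 1]) (auto simp: indicator_def)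
  moreover have "continuous_on (closure \<Omega>) (indicator (closure \<Omega>) :: 'a \<Rightarrow> real)"
    by (rule continuous_on_eq[of _ "\<lambda>x. 1"]) auto
  ultimately show ?thesis
    unfolding P1_def by (auto simp: indicator_def)
qed

text \<open>A discrete maximum principle: every cell is the hull of its vertices, all of which are
  nodes, and off the closure the representative is zero.\<close>

lemma P1_nonneg:
  assumes v: "v \<in> P1 \<Omega> T" and nodes: "\<And>a. a \<in> nodes T \<Longrightarrow> 0 \<le> v a"
  shows "0 \<le> v x"
proof (cases "x \<in> closure \<Omega>")
  case True
  then obtain K where K: "K \<in> T" "x \<in> K"
    using Union_cells by auto
  obtain p c where pc: "\<forall>x\<in>K. v x = p \<bullet> x + c"
    using P1_cell[OF v K(1)] by blast
  have "0 \<le> p \<bullet> b + c" if "b extreme_point_of K" for b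
    using that nodes[of b] pc K(1) by (auto simp: nodes_def extreme_point_of_def)
  then show ?thesis
    using affine_nonneg_from_extreme_points[OF cell_compact cell_convex, of K] K pc by auto
qed (simp add: P1_outside[OF v])

text \<open>Applying \<open>P1_nonneg\<close> to both differences gives unisolvence of the nodal
  values. Equality holds on the whole space because representatives vanish outside the
  closure.\<close>

lemma P1_eqI:
  assumes "v \<in> P1 \<Omega> T" "w \<in> P1 \<Omega> T" "\<And>a. a \<in> nodes T \<Longrightarrow> v a = w a"
  shows "v = w"
proof
  fix x
  show "v x = w x"
    using P1_nonneg[OF P1_diff[OF assms(1,2)], of x] P1_nonneg[OF P1_diff[OF assms(2,1)], of x]
      assms(3) by simp
qed

text \<open>Barycentric coordinates on neighbouring cells agree on the common face because they agree at
  its vertices, so they glue.\<close>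

lemma hat_function_exists: "\<exists>\<phi>\<in>P1 \<Omega> T. \<forall>b\<in>nodes T. \<phi> b = (if b = a then 1 else 0)"
proof -
  define g :: "'a \<Rightarrow> real" where "g b = (if b = a then 1 else 0)" for b
  have "\<exists>p c. \<forall>b. b extreme_point_of K \<longrightarrow> p \<bullet> b + c = g b" if K: "K \<in> T" for K
  proof -
    obtain C where C: "\<not> affine_dependent C" "K = convex hull C"
      using cell_simplex[OF K] by (auto simp: simplex_def)
    show ?thesis
      by (rule affine_independent_interpolation[OF C(1), of g])
        (auto simp: C(2) extreme_point_of_convex_hull_affine_independent[OF C(1)])
  qed
  then obtain p c where pc: "\<And>K b. K \<in> T \<Longrightarrow> b extreme_point_of K \<Longrightarrow> p K \<bullet> b + c K = g b"
    by metis
  \<comment> \<open>By conformity \<open>K \<inter> L\<close> is a face of both cells, so its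
    extreme points are vertices of both, where the two affine functions take the value
    \<open>g\<close>. One inequality suffices, since \<open>K\<close> and \<open>L\<close> can be
    exchanged.\<close>
  have le: "p K \<bullet> x + c K \<le> p L \<bullet> x + c L" if KL: "K \<in> T" "L \<in> T" and x: "x \<in> K" "x \<in> L" for K L x
  proof -
    have F: "(K \<inter> L) face_of K" "(K \<inter> L) face_of L"
      using Int_cells_face[of K L] Int_cells_face[of L K] KL by (auto simp: Int_commute)
    have "0 \<le> (p L - p K) \<bullet> x + (c L - c K)"
    proof (rule affine_nonneg_from_extreme_points[of "K \<inter> L"])
      show "compact (K \<inter> L)" "convex (K \<inter> L)"
        using KL by (auto intro: compact_Int cell_compact convex_Int cell_convex)
      fix b assume "b extreme_point_of (K \<inter> L)"
      then have "b extreme_point_of K" "b extreme_point_of L"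
        using extreme_point_of_face F by blast+
      then show "0 \<le> (p L - p K) \<bullet> b + (c L - c K)"
        using pc[of K b] pc[of L b] KL by (simp add: inner_diff_left)
    qed (use x in simp)
    then show ?thesis by (simp add: inner_diff_left)
  qed
  \<comment> \<open>Any cell containing the point may be chosen: by \<open>le\<close> all of them
    give the same value.\<close>
  define \<phi> where "\<phi> x = (if x \<in> \<Union>T then let K = SOME K. K \<in> T \<and> x \<in> K in p K \<bullet> x + c K else 0)" for x
  have \<phi>: "\<phi> x = p K \<bullet> x + c K" if "K \<in> T" "x \<in> K" for K x
  proof -
    define L where "L = (SOME K. K \<in> T \<and> x \<in> K)"
    have L: "L \<in> T" "x \<in> L"
      using someI[of "\<lambda>K. K \<in> T \<and> x \<in> K" K] that by (auto simp: L_def)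
    have "\<phi> x = p L \<bullet> x + c L"
      using that by (auto simp: \<phi>_def L_def Let_def)
    then show ?thesis
      using le[of K L x] le[of L K x] that L by simp
  qed
  have "continuous_on K \<phi>" if "K \<in> T" for K
    by (rule continuous_on_eq[of _ "\<lambda>x. p K \<bullet> x + c K"])
      (auto simp: \<phi>[OF that] intro!: continuous_intros)
  then have "continuous_on (\<Union>K\<in>T. K) \<phi>"
    using finite_cells cell_compact compact_imp_closed
    by (intro continuous_on_closed_Union) auto
  moreover have "\<phi> x = 0" if "x \<notin> closure \<Omega>" for x
    using that Union_cells by (auto simp: \<phi>_def)
  moreover have "\<exists>q d. \<forall>x\<in>K. \<phi> x = q \<bullet> x + d" if "K \<in> T" for K
    using \<phi>[OF that] by blast
  ultimately have "\<phi> \<in> P1 \<Omega> T"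
    using Union_cells by (auto simp: P1_def)
  moreover have "\<phi> b = g b" if b: "b \<in> nodes T" for b
  proof -
    obtain K where K: "K \<in> T" "b extreme_point_of K"
      using b by (auto simp: nodes_def)
    then have "b \<in> K" by (simp add: extreme_point_of_def)
    then show ?thesis
      using pc[OF K] \<phi>[OF K(1), of b] by simp
  qed
  ultimately show ?thesis
    by (auto simp: g_def intro!: bexI[of _ \<phi>])
qed

section \<open>Nodal basis and interpolation\<close>

text \<open>The definite description is resolved by \<open>hat_function_exists\<close> for existence
  and \<open>P1_eqI\<close> for uniqueness.\<close>

lemma nodal_basis:
  shows nodal_basis_P1: "nodal_basis \<Omega> T a \<in> P1 \<Omega> T"
    and nodal_basis_node: "b \<in> nodes T \<Longrightarrow> nodal_basis \<Omega> T a b = (if b = a then 1 else 0)"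
proof -
  have "\<exists>!\<phi>. \<phi> \<in> P1 \<Omega> T \<and> (\<forall>b\<in>nodes T. \<phi> b = (if b = a then 1 else 0))"
  proof (rule ex_ex1I)
    show "\<exists>\<phi>. \<phi> \<in> P1 \<Omega> T \<and> (\<forall>b\<in>nodes T. \<phi> b = (if b = a then 1 else 0))"
      using hat_function_exists[of a] by blast
  qed (rule P1_eqI, simp_all)
  from theI'[OF this]
  show "nodal_basis \<Omega> T a \<in> P1 \<Omega> T"
    and "b \<in> nodes T \<Longrightarrow> nodal_basis \<Omega> T a b = (if b = a then 1 else 0)"
    unfolding nodal_basis_def by blast+
qed

lemma nodal_interp_P1: "nodal_interp \<Omega> T f \<in> P1 \<Omega> T"
  unfolding nodal_interp_def by (intro P1_sum P1_scale nodal_basis_P1)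

lemma nodal_interp_node: "b \<in> nodes T \<Longrightarrow> nodal_interp \<Omega> T f b = f b"
  unfolding nodal_interp_def
  by (simp add: nodal_basis_node finite_nodes if_distrib[of "\<lambda>x. f _ * x"] sum.delta cong: if_cong)

lemma nodal_interp_eq: "v \<in> P1 \<Omega> T \<Longrightarrow> nodal_interp \<Omega> T v = v"
  by (intro P1_eqI nodal_interp_P1) (simp_all add: nodal_interp_node)

lemma nodal_interp_cong:
  "(\<And>a. a \<in> nodes T \<Longrightarrow> f a = g a) \<Longrightarrow> nodal_interp \<Omega> T f = nodal_interp \<Omega> T g"
  by (intro P1_eqI nodal_interp_P1) (simp_all add: nodal_interp_node)

lemma nodal_interp_nonneg:
  "(\<And>a. a \<in> nodes T \<Longrightarrow> 0 \<le> f a) \<Longrightarrow> 0 \<le> nodal_interp \<Omega> T f x"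
  by (rule P1_nonneg[OF nodal_interp_P1]) (simp add: nodal_interp_node)

section \<open>The lumped product\<close>

lemma lumped_inner_eq_0:
  assumes "\<And>a. a \<in> nodes T \<Longrightarrow> v a \<bullet> w a = 0"
  shows "lumped_inner \<Omega> T v w = 0"
proof -
  have "nodal_interp \<Omega> T (\<lambda>y. v y \<bullet> w y) = nodal_interp \<Omega> T (\<lambda>y. 0)"
    using assms by (intro nodal_interp_cong)
  then show ?thesis
    by (simp add: lumped_inner_def nodal_interp_def)
qed

text \<open>Cancelling the square root requires a nonnegative integral. The nodal values of the
  integrand are squares, so its interpolant is nonnegative everywhere.\<close>

lemma lumped_norm_square: "(lumped_norm \<Omega> T v)\<^sup>2 = lumped_inner \<Omega> T v v"
  unfolding lumped_norm_def lumped_inner_def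
  by (intro real_sqrt_pow2 Bochner_Integration.integral_nonneg nodal_interp_nonneg inner_ge_zero)

section \<open>Orthogonality in \<open>L2\<close> and the nodal constraint\<close>

lemma integrable_on_domain:
  fixes f :: "'a \<Rightarrow> real"
  assumes "continuous_on (closure \<Omega>) f"
  shows "integrable (lebesgue_on \<Omega>) f"
proof -
  obtain B where B: "\<And>x. x \<in> closure \<Omega> \<Longrightarrow> norm (f x) \<le> B"
    using compact_imp_bounded[OF compact_continuous_image[OF assms compact_closure_domain]]
    by (auto simp: bounded_iff)
  have \<Omega>: "\<Omega> \<in> sets lebesgue"
    using domain_lmeasurable by blast
  have "f absolutely_integrable_on \<Omega>"
  proof (rule measurable_bounded_by_integrable_imp_absolutely_integrable)
    show "f \<in> borel_measurable (lebesgue_on \<Omega>)"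
      by (rule continuous_imp_measurable_on_sets_lebesgue[OF continuous_on_subset[OF assms closure_subset] \<Omega>])
    show "(\<lambda>x. B) integrable_on \<Omega>"
      using domain_lmeasurable by (simp add: integrable_on_const)
    show "norm (f x) \<le> B" if "x \<in> \<Omega>" for x
      using B[of x] that closure_subset[of \<Omega>] by blast
  qed (rule \<Omega>)
  then show ?thesis
    unfolding set_integrable_def using \<Omega> by (subst integrable_restrict_space) simp_all
qed

text \<open>The difference of the two functions is itself an admissible test function, so its
  \<open>L2\<close> norm vanishes. The indicator truncates \<open>w\<close> to the representative
  that is zero off the closure; this allows \<open>w\<close> to be the constant 1.\<close>

lemma P1_L2_orthogonal_imp_eq:
  assumes v: "v \<in> P1 \<Omega> T" and w: "continuous_on (closure \<Omega>) w"
    and vw: "(\<lambda>x. v x - indicator (closure \<Omega>) x * w x) \<in> P1 \<Omega> T"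
    and orth: "\<And>r. r \<in> P1 \<Omega> T \<Longrightarrow> L2_inner \<Omega> v r = L2_inner \<Omega> w r"
    and x: "x \<in> closure \<Omega>"
  shows "v x = w x"
proof -
  define r where "r = (\<lambda>y. v y - indicator (closure \<Omega>) y * w y)"
  have r: "r \<in> P1 \<Omega> T"
    using vw by (simp add: r_def)
  have r_eq: "r y = v y - w y" if "y \<in> closure \<Omega>" for y
    using that by (simp add: r_def)
  have [continuous_intros]: "continuous_on (closure \<Omega>) v" "continuous_on (closure \<Omega>) r"
    using v r P1_continuous by auto
  note [continuous_intros] = w
  have sub: "y \<in> closure \<Omega>" if "y \<in> \<Omega>" for y
    using that closure_subset by blast
  have int: "integrable (lebesgue_on \<Omega>) (\<lambda>x. v x * r x)"
    "integrable (lebesgue_on \<Omega>) (\<lambda>x. w x * r x)" "integrable (lebesgue_on \<Omega>) (\<lambda>x. r x * r x)"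
    by (intro integrable_on_domain continuous_intros)+
  have "(LINT x|lebesgue_on \<Omega>. r x * r x) = (LINT x|lebesgue_on \<Omega>. v x * r x - w x * r x)"
    by (rule Bochner_Integration.integral_cong) (auto simp: r_eq sub algebra_simps)
  also have "\<dots> = 0"
    using orth[OF r] int by (simp add: L2_inner_def)
  finally have "AE x in lebesgue_on \<Omega>. r x * r x = 0"
    using integral_nonneg_eq_0_iff_AE[OF int(3)] by simp
  then have "AE x in lebesgue. x \<in> \<Omega> \<longrightarrow> r x = 0"
    using domain_lmeasurable by (subst (asm) AE_restrict_space_iff) auto
  then have "negligible {x. \<not> (x \<in> \<Omega> \<longrightarrow> r x = 0)}"
    by (simp add: negligible_iff_null_sets completion.AE_iff_null_sets)
  \<comment> \<open>Passage from almost everywhere to everywhere: the set where \<open>r\<close> is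
    nonzero is open and negligible, hence empty. Continuity then carries \<open>r = 0\<close> from
    the domain to its closure.\<close>
  moreover have "open {x \<in> \<Omega>. r x \<in> - {0}}"
    using continuous_on_subset[OF P1_continuous[OF r] closure_subset] open_domain
    by (intro continuous_open_preimage[unfolded vimage_def Int_def mem_Collect_eq]) auto
  ultimately have "{x \<in> \<Omega>. r x \<in> - {0}} = {}"
    using open_not_negligible by fastforce
  then have "r x = 0"
    using continuous_constant_on_closure[OF P1_continuous[OF r], of 0 x] x by auto
  then show ?thesis
    using r_eq x by simp
qed

lemma nodal_constraint:
  assumes "\<And>r. r \<in> P1 \<Omega> T \<Longrightarrow>
      L2_inner \<Omega> (nodal_interp \<Omega> T f) r = L2_inner \<Omega> (\<lambda>x. 1) r"
    and a: "a \<in> nodes T"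
  shows "f a = 1"
proof -
  have "nodal_interp \<Omega> T f a = 1"
    by (rule P1_L2_orthogonal_imp_eq[OF nodal_interp_P1 _ _ assms(1) node_in_closure[OF a]])
      (use P1_diff[OF nodal_interp_P1 P1_one] in auto)
  then show ?thesis
    using a by (simp add: nodal_interp_node)
qed

section \<open>The mesh skeleton\<close>

text \<open>A closed null set; every point of the domain outside it is interior to a cell, where
  discrete functions are affine and classical gradients exist.\<close>

definition skeleton :: "'a set" where
  "skeleton = (\<Union>K\<in>T. frontier K)"

lemma closed_skeleton: "closed skeleton"
  unfolding skeleton_def using finite_cells by auto

lemma negligible_skeleton: "negligible skeleton"
  unfolding skeleton_def using finite_cells cell_convex negligible_convex_frontier by auto

lemma off_skeleton_interior:
  assumes "x \<in> \<Omega> - skeleton"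
  obtains K where "K \<in> T" "x \<in> interior K"
proof -
  have "x \<in> \<Union>T"
    using assms closure_subset Union_cells by blast
  then show ?thesis
    using that assms closure_subset by (fastforce simp: skeleton_def frontier_def)
qed

lemma AE_off_skeleton: "AE x in lebesgue_on \<Omega>. x \<in> \<Omega> - skeleton"
proof -
  have "AE x in lebesgue. x \<notin> skeleton"
    using negligible_skeleton by (auto simp: negligible_iff_null_sets intro: AE_not_in)
  then show ?thesis
    using domain_lmeasurable by (subst AE_restrict_space_iff) auto
qed

end

section \<open>One-sided derivatives in time\<close>

text \<open>Bridges the difference quotients in \<open>smooth_curve\<close> and the library notion
  of derivative. The quotient at \<open>s = t\<close> is irrelevant, since the filter ignores that
  point.\<close>

lemma has_vector_derivative_within_quotient:
  assumes "((\<lambda>s. (f s - f t) /\<^sub>R (s - t)) \<longlongrightarrow> f') (at t within S)"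
  shows "(f has_vector_derivative f') (at t within S)"
  unfolding has_vector_derivative_def has_derivative_iff_norm
proof
  have "((\<lambda>s. norm ((f s - f t) /\<^sub>R (s - t) - f')) \<longlongrightarrow> 0) (at t within S)"
    by (intro tendsto_norm_zero LIM_zero assms)
  moreover have "\<forall>\<^sub>F s in at t within S. norm ((f s - f t) /\<^sub>R (s - t) - f') =
      norm (f s - f t - (s - t) *\<^sub>R f') / norm (s - t)"
    unfolding eventually_at_filter
  proof (intro always_eventually allI impI)
    fix s assume "s \<noteq> t"
    then have "(f s - f t) /\<^sub>R (s - t) - f' = (f s - f t - (s - t) *\<^sub>R f') /\<^sub>R (s - t)"
      by (simp add: scaleR_diff_right)
    then show "norm ((f s - f t) /\<^sub>R (s - t) - f') = norm (f s - f t - (s - t) *\<^sub>R f') / norm (s - t)"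
      by (simp add: divide_inverse mult.commute)
  qed
  ultimately show "((\<lambda>s. norm (f s - f t - (s - t) *\<^sub>R f') / norm (s - t)) \<longlongrightarrow> 0) (at t within S)"
    by (rule Lim_transform_eventually)
qed (rule bounded_linear_scaleR_left)

text \<open>Makes derivatives along the half-line unique, including the one-sided derivative at its
  endpoint.\<close>

lemma at_within_Ici_neq_bot: "at t within {a..} \<noteq> bot" if "a \<le> t" for a t :: real
  using islimpt_subset[OF islimpt_greaterThanLessThan1[of t "t + 1"], of "{a..}"] that
  by (auto simp: trivial_limit_within subset_eq)

section \<open>Vector-valued elements and their gradients\<close>

locale vector_mesh = mesh \<Omega> T for \<Omega> :: "(real^'n) set" and T
begin

text \<open>The index pairs a node with a component, so a discrete vector field has one scalar
  coefficient per degree of freedom.\<close>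

definition vec_basis :: "(real^'n) \<times> 'n \<Rightarrow> real^'n \<Rightarrow> real^'n" where
  "vec_basis p = (\<lambda>x. nodal_basis \<Omega> T (fst p) x *\<^sub>R axis (snd p) 1)"

abbreviation dofs :: "((real^'n) \<times> 'n) set" where
  "dofs \<equiv> nodes T \<times> UNIV"

lemma vec_basis_P1: "vec_basis p \<in> P1_vec \<Omega> T"
proof -
  have "(\<lambda>x. vec_basis p x $ i) = (\<lambda>x. (axis (snd p) 1 $ i) * nodal_basis \<Omega> T (fst p) x)" for i
    by (simp add: vec_basis_def mult.commute)
  then show ?thesis
    by (simp add: P1_vec_def P1_scale nodal_basis_P1)
qed

lemma P1_vec_expansion:
  assumes "v \<in> P1_vec \<Omega> T"
  shows "v = (\<lambda>x. \<Sum>p\<in>dofs. (v (fst p) $ snd p) *\<^sub>R vec_basis p x)"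
proof (intro ext iffD2[OF vec_eq_iff] allI)
  fix x i
  have "v x $ i = (\<Sum>a\<in>nodes T. v a $ i * nodal_basis \<Omega> T a x)"
    using nodal_interp_eq[of "\<lambda>x. v x $ i"] assms
    by (auto simp: P1_vec_def nodal_interp_def fun_eq_iff)
  \<comment> \<open>The inserted sum over \<open>j\<close> contains a Kronecker delta that selects
    \<open>j = i\<close>.\<close>
  also have "\<dots> = (\<Sum>a\<in>nodes T. \<Sum>j\<in>UNIV. v a $ j * (nodal_basis \<Omega> T a x * axis j 1 $ i))"
    by (intro sum.cong refl, subst sum.remove[OF _ UNIV_I[of i]]) (simp_all add: axis_def)
  also have "\<dots> = (\<Sum>p\<in>dofs. (v (fst p) $ snd p) *\<^sub>R vec_basis p x) $ i"
    by (simp add: sum.cartesian_product sum_component vec_basis_def case_prod_beta mult.assoc)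
  finally show "v x $ i = (\<Sum>p\<in>dofs. (v (fst p) $ snd p) *\<^sub>R vec_basis p x) $ i" .
qed

lemma grad_eqI: "(v has_derivative (\<lambda>h. A *v h)) (at x) \<Longrightarrow> grad v x = A"
  for A :: "real^'n^'n"
  unfolding grad_def jacobian_def
  by (metis frechet_derivative_at matrix_of_matrix_vector_mul)

text \<open>The slopes of the components form the rows of the matrix. It is chosen before the point,
  which makes the gradient constant in the interior of each cell.\<close>

lemma P1_vec_cell_derivative:
  assumes v: "v \<in> P1_vec \<Omega> T" and K: "K \<in> T"
  obtains A where "\<And>x. x \<in> interior K \<Longrightarrow> (v has_derivative (\<lambda>h. A *v h)) (at x)"
proof -
  have "\<exists>p c. \<forall>x\<in>K. v x $ i = p \<bullet> x + c" for i
    using P1_cell[of "\<lambda>x. v x $ i", OF _ K] v by (simp add: P1_vec_def)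
  then obtain p c where pc: "\<And>i x. x \<in> K \<Longrightarrow> v x $ i = p i \<bullet> x + c i"
    by metis
  have affine: "v x = (\<chi> i. p i) *v x + (\<chi> i. c i)" if "x \<in> K" for x
    using pc[OF that] by (simp add: vec_eq_iff matrix_vector_mult_def inner_vec_def)
  show thesis
  proof
    fix x assume x: "x \<in> interior K"
    have "((\<lambda>x. (\<chi> i. p i) *v x + (\<chi> i. c i)) has_derivative (\<lambda>h. (\<chi> i. p i) *v h)) (at x)"
      by (intro has_derivative_add_const bounded_linear_imp_has_derivative
          matrix_vector_mul_bounded_linear)
    then show "(v has_derivative (\<lambda>h. (\<chi> i. p i) *v h)) (at x)"
      by (rule has_derivative_transform_within_open[OF _ open_interior x])
        (use affine interior_subset in force)
  qed
qed

lemma grad_has_derivative: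
  assumes v: "v \<in> P1_vec \<Omega> T" and x: "x \<in> \<Omega> - skeleton"
  shows "(v has_derivative (\<lambda>h. grad v x *v h)) (at x)"
proof -
  obtain K where K: "K \<in> T" "x \<in> interior K"
    using off_skeleton_interior[OF x] .
  obtain A where "(v has_derivative (\<lambda>h. A *v h)) (at x)"
    using P1_vec_cell_derivative[OF v K(1)] K(2) by metis
  with grad_eqI[OF this] show ?thesis by simp
qed

lemma grad_locally_constant:
  assumes "v \<in> P1_vec \<Omega> T" "K \<in> T"
  obtains A where "\<And>x. x \<in> interior K \<Longrightarrow> grad v x = A"
  by (rule P1_vec_cell_derivative[OF assms]) (metis grad_eqI that)

text \<open>Linearity of the derivative applied to the nodal expansion; off the skeleton all basis
  functions are differentiable.\<close>

lemma grad_expansion: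
  assumes v: "v \<in> P1_vec \<Omega> T" and x: "x \<in> \<Omega> - skeleton"
  shows "grad v x = (\<Sum>p\<in>dofs. (v (fst p) $ snd p) *\<^sub>R grad (vec_basis p) x)"
proof (rule grad_eqI)
  have mv: "(\<Sum>p\<in>I. c p *\<^sub>R A p) *v h = (\<Sum>p\<in>I. c p *\<^sub>R (A p *v h))"
    for I and c :: "_ \<Rightarrow> real" and A :: "_ \<Rightarrow> real^'n^'n" and h
    by (induction I rule: infinite_finite_induct)
      (simp_all add: matrix_vector_mult_add_rdistrib scaleR_matrix_vector_assoc)
  have "((\<lambda>x. \<Sum>p\<in>dofs. (v (fst p) $ snd p) *\<^sub>R vec_basis p x) has_derivative
      (\<lambda>h. \<Sum>p\<in>dofs. (v (fst p) $ snd p) *\<^sub>R (grad (vec_basis p) x *v h))) (at x)"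
    by (intro has_derivative_sum has_derivative_scaleR_right grad_has_derivative vec_basis_P1 x)
  then show "(v has_derivative
      (\<lambda>h. (\<Sum>p\<in>dofs. (v (fst p) $ snd p) *\<^sub>R grad (vec_basis p) x) *v h)) (at x)"
    using P1_vec_expansion[OF v] by (simp add: mv)
qed

text \<open>Off the skeleton the integrand is locally constant with one value per cell, hence
  continuous and bounded on an open set of finite measure. Restoring the skeleton changes only a
  null set.\<close>

lemma grad_inner_integrable:
  assumes v: "v \<in> P1_vec \<Omega> T" and w: "w \<in> P1_vec \<Omega> T"
  shows "integrable (lebesgue_on \<Omega>) (\<lambda>x. grad v x \<bullet> grad w x)"
proof -
  let ?F = "\<lambda>x. grad v x \<bullet> grad w x" and ?S = "\<Omega> - skeleton"
  have "\<exists>d. \<forall>x\<in>interior K. ?F x = d" if "K \<in> T" for K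
    using grad_locally_constant[OF v that] grad_locally_constant[OF w that] by metis
  then obtain d where d: "\<And>K x. K \<in> T \<Longrightarrow> x \<in> interior K \<Longrightarrow> ?F x = d K"
    by metis
  have S: "open ?S" "?S \<in> lmeasurable"
    using open_domain closed_skeleton domain_lmeasurable
    by (auto intro: fmeasurable.Diff negligible_imp_measurable[OF negligible_skeleton] open_Diff)
  have "continuous_on ?S ?F"
  proof (rule continuous_at_imp_continuous_on, rule ballI)
    fix x assume "x \<in> ?S"
    then obtain K where K: "K \<in> T" "x \<in> interior K"
      using off_skeleton_interior by blast
    have "\<forall>\<^sub>F y in nhds x. ?F y = d K"
      using K d by (auto simp: eventually_nhds intro!: exI[of _ "interior K"])
    then show "isCont ?F x"
      by (simp add: isCont_cong)
  qed
  moreover have "norm (?F x) \<le> (\<Sum>K\<in>T. \<bar>d K\<bar>)" if x: "x \<in> ?S" for x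
  proof -
    obtain K where K: "K \<in> T" "x \<in> interior K"
      using off_skeleton_interior[OF x] .
    then show ?thesis
      using d[OF K] member_le_sum[of K T "\<lambda>K. \<bar>d K\<bar>"] finite_cells by simp
  qed
  moreover have "(\<lambda>x. \<Sum>K\<in>T. \<bar>d K\<bar>) integrable_on ?S"
    using S(2) by (simp add: integrable_on_const)
  ultimately have "?F absolutely_integrable_on ?S"
    using S by (intro measurable_bounded_by_integrable_imp_absolutely_integrable
        continuous_imp_measurable_on_sets_lebesgue) auto
  moreover have "negligible {x \<in> ?S - \<Omega>. ?F x \<noteq> 0}" "negligible {x \<in> \<Omega> - ?S. ?F x \<noteq> 0}"
    by (auto intro: negligible_subset[OF negligible_skeleton])
  ultimately have "?F absolutely_integrable_on \<Omega>"
    using absolutely_integrable_spike_set by blast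
  then show ?thesis
    unfolding set_integrable_def
    using domain_lmeasurable by (subst integrable_restrict_space) auto
qed

section \<open>The Dirichlet form in nodal coordinates\<close>

text \<open>The inner products of basis gradients form the stiffness matrix. For a curve of discrete
  functions it is fixed in time, so all time dependence sits in finitely many scalar
  coefficients.\<close>

lemma dirichlet_expansion:
  assumes v: "v \<in> P1_vec \<Omega> T" and w: "w \<in> P1_vec \<Omega> T"
  shows "L2_inner \<Omega> (grad v) (grad w) =
    (\<Sum>p\<in>dofs. \<Sum>q\<in>dofs. (v (fst p) $ snd p) * (w (fst q) $ snd q) *
       L2_inner \<Omega> (grad (vec_basis p)) (grad (vec_basis q)))"
proof -
  have int [intro]: "integrable (lebesgue_on \<Omega>) (\<lambda>x. grad (vec_basis p) x \<bullet> grad (vec_basis q) x)"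
    for p q
    by (intro grad_inner_integrable vec_basis_P1)
  let ?G = "\<lambda>x. \<Sum>p\<in>dofs. \<Sum>q\<in>dofs. (v (fst p) $ snd p) * (w (fst q) $ snd q) *
      (grad (vec_basis p) x \<bullet> grad (vec_basis q) x)"
  have "grad v x \<bullet> grad w x = ?G x" if "x \<in> \<Omega> - skeleton" for x
    unfolding grad_expansion[OF v that] grad_expansion[OF w that]
    by (simp only: inner_sum_left) (simp add: inner_sum_right sum_distrib_left mult_ac)
  moreover have G: "integrable (lebesgue_on \<Omega>) ?G"
    by (intro Bochner_Integration.integrable_sum integrable_mult_right int)
  ultimately have "L2_inner \<Omega> (grad v) (grad w) = integral\<^sup>L (lebesgue_on \<Omega>) ?G"
    unfolding L2_inner_def
    using grad_inner_integrable[OF v w]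
    by (intro integral_cong_AE eventually_mono[OF AE_off_skeleton]) auto
  also have "\<dots> = (\<Sum>p\<in>dofs. \<Sum>q\<in>dofs. (v (fst p) $ snd p) * (w (fst q) $ snd q) *
       L2_inner \<Omega> (grad (vec_basis p)) (grad (vec_basis q)))"
    unfolding L2_inner_def
    by (subst Bochner_Integration.integral_sum Bochner_Integration.integral_mult_right,
        intro Bochner_Integration.integrable_sum integrable_mult_right int)+ simp
  finally show ?thesis .
qed

text \<open>The energy is a quadratic form in the nodal coefficients, so the product rule replaces
  differentiation under the integral. Symmetry of the stiffness matrix produces the factor
  2.\<close>

lemma dirichlet_has_derivative:
  assumes u: "\<And>s. s \<in> S \<Longrightarrow> u s \<in> P1_vec \<Omega> T" and u': "u' \<in> P1_vec \<Omega> T" and t: "t \<in> S"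
    and deriv: "\<And>a. a \<in> nodes T \<Longrightarrow> ((\<lambda>s. u s a) has_vector_derivative u' a) (at t within S)"
  shows "((\<lambda>s. L2_inner \<Omega> (grad (u s)) (grad (u s))) has_real_derivative
    2 * L2_inner \<Omega> (grad (u t)) (grad u')) (at t within S)"
proof -
  define c where "c p s = u s (fst p) $ snd p" for p s
  define c' where "c' p = u' (fst p) $ snd p" for p
  define B where "B p q = L2_inner \<Omega> (grad (vec_basis p)) (grad (vec_basis q))" for p q
  have c: "(c p has_real_derivative c' p) (at t within S)" if "p \<in> dofs" for p
    using bounded_linear.has_vector_derivative[OF bounded_linear_vec_nth deriv, of "fst p" "snd p"] that
    unfolding has_real_derivative_iff_has_vector_derivative c_def[abs_def] c'_def by auto
  have B_sym: "B p q = B q p" for p q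
    by (simp add: B_def L2_inner_def inner_commute)
  have "((\<lambda>s. \<Sum>p\<in>dofs. \<Sum>q\<in>dofs. c p s * c q s * B p q) has_real_derivative
      (\<Sum>p\<in>dofs. \<Sum>q\<in>dofs. (c' p * c q t + c' q * c p t) * B p q)) (at t within S)"
    by (intro DERIV_sum DERIV_cmult_right DERIV_mult c)
  also have "(\<Sum>p\<in>dofs. \<Sum>q\<in>dofs. (c' p * c q t + c' q * c p t) * B p q) =
      (\<Sum>p\<in>dofs. \<Sum>q\<in>dofs. c q t * c' p * B q p) + (\<Sum>p\<in>dofs. \<Sum>q\<in>dofs. c p t * c' q * B p q)"
    unfolding sum.distrib[symmetric]
    by (intro sum.cong refl) (simp add: algebra_simps B_sym)
  \<comment> \<open>The first sum was written with \<open>B q p\<close> by symmetry, so exchanging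
    the order of summation turns it into the second.\<close>
  also have "(\<Sum>p\<in>dofs. \<Sum>q\<in>dofs. c q t * c' p * B q p) =
      (\<Sum>p\<in>dofs. \<Sum>q\<in>dofs. c p t * c' q * B p q)"
    by (rule sum.swap)
  finally have "((\<lambda>s. \<Sum>p\<in>dofs. \<Sum>q\<in>dofs. c p s * c q s * B p q) has_real_derivative
      2 * L2_inner \<Omega> (grad (u t)) (grad u')) (at t within S)"
    using dirichlet_expansion[OF u[OF t] u'] by (simp add: c_def c'_def B_def)
  \<comment> \<open>The expansion of the energy is available for times in \<open>S\<close>, so the
    functions are compared within \<open>S\<close> only; the radius 1 is arbitrary.\<close>
  then show ?thesis
    by (rule has_field_derivative_transform_within[OF _ zero_less_one t])
      (simp add: dirichlet_expansion u c_def B_def)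
qed

section \<open>Discrete curves and the energy law\<close>

lemma P1_vec_outside: "v \<in> P1_vec \<Omega> T \<Longrightarrow> x \<notin> closure \<Omega> \<Longrightarrow> v x = 0"
  by (auto simp: P1_vec_def vec_eq_iff dest: P1_outside)

text \<open>Uniform convergence on the closure gives pointwise convergence there, and off the
  closure every discrete function vanishes. Hence \<open>time_deriv u t\<close> equals the witness
  \<open>D 1 t\<close>, a member of the discrete space and so an admissible test function.\<close>

lemma smooth_curve_time_deriv:
  assumes u: "smooth_curve (closure \<Omega>) (P1_vec \<Omega> T) u" and t: "t \<ge> 0"
  shows "u t \<in> P1_vec \<Omega> T" "time_deriv u t \<in> P1_vec \<Omega> T"
    and "((\<lambda>s. u s x) has_vector_derivative time_deriv u t x) (at t within {0..})"
proof -
  obtain D where D0: "D 0 = u" and DV: "\<And>k t. t \<ge> 0 \<Longrightarrow> D k t \<in> P1_vec \<Omega> T"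
    and lim: "\<And>k t. t \<ge> 0 \<Longrightarrow> uniform_limit (closure \<Omega>)
           (\<lambda>s x. (D k s x - D k t x) /\<^sub>R (s - t)) (D (Suc k) t) (at t within {0..})"
    using u unfolding smooth_curve_def by blast
  show "u t \<in> P1_vec \<Omega> T"
    using DV[OF t, of 0] D0 by simp
  have deriv: "((\<lambda>s. u s x) has_vector_derivative D 1 t x) (at t within {0..})" for x
  proof (cases "x \<in> closure \<Omega>")
    case True
    then have "((\<lambda>s. (u s x - u t x) /\<^sub>R (s - t)) \<longlongrightarrow> D 1 t x) (at t within {0..})"
      using tendsto_uniform_limitI[OF lim[OF t, of 0]] D0 by simp
    then show ?thesis
      by (rule has_vector_derivative_within_quotient)
  next
    case False
    have "((\<lambda>s. 0) has_vector_derivative D 1 t x) (at t within {0..})"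
      using P1_vec_outside[OF DV[OF t, of 1] False] by simp
    then show ?thesis
      by (rule has_vector_derivative_transform[rotated 2])
        (use t False P1_vec_outside DV[of _ 0] D0 in auto)
  qed
  have "time_deriv u t = D 1 t"
    unfolding time_deriv_def by (intro ext vector_derivative_within at_within_Ici_neq_bot t deriv)
  then show "time_deriv u t \<in> P1_vec \<Omega> T"
    and "((\<lambda>s. u s x) has_vector_derivative time_deriv u t x) (at t within {0..})"
    using DV[OF t] deriv by auto
qed

text \<open>Testing with the time derivative kills the multiplier term, since the nodal constraint makes
  it orthogonal to \<open>u\<close>; the hypothesis \<open>R_eq_0\<close> does the same for the additional term.\<close>

lemma discrete_energy_law:
  assumes u: "smooth_curve (closure \<Omega>) (P1_vec \<Omega> T) u"
    and eq: "\<And>t v. t \<ge> 0 \<Longrightarrow> v \<in> P1_vec \<Omega> T \<Longrightarrow>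
          lumped_inner \<Omega> T (time_deriv u t) v +
          \<gamma> * L2_inner \<Omega> (grad (u t)) (grad v) +
          \<gamma> * L2_inner \<Omega> (q t) (nodal_interp \<Omega> T (\<lambda>x. u t x \<bullet> v x)) + R t v = 0"
    and R_eq_0: "\<And>t. t \<ge> 0 \<Longrightarrow> R t (time_deriv u t) = 0"
    and constraint: "\<And>t r. t \<ge> 0 \<Longrightarrow> r \<in> P1 \<Omega> T \<Longrightarrow>
          L2_inner \<Omega> (nodal_interp \<Omega> T (\<lambda>x. u t x \<bullet> u t x)) r = L2_inner \<Omega> (\<lambda>x. 1) r"
    and t: "t \<ge> 0"
  shows "\<forall>a\<in>nodes T. norm (u t a) = 1"
    and "integral {0..t} (\<lambda>s. (lumped_norm \<Omega> T (time_deriv u s))\<^sup>2) +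
            \<gamma> / 2 * (L2_norm \<Omega> (grad (u t)))\<^sup>2 = \<gamma> / 2 * (L2_norm \<Omega> (grad (u 0)))\<^sup>2"
proof -
  have unit: "u s a \<bullet> u s a = 1" if "s \<ge> 0" "a \<in> nodes T" for s a
    using nodal_constraint[OF constraint[OF that(1)] that(2)] .
  show "\<forall>a\<in>nodes T. norm (u t a) = 1"
    using unit[OF t] by (simp add: norm_eq_1)
  \<comment> \<open>At a node \<open>u \<bullet> u\<close> is constantly 1 on the half-line, so its
    derivative is both 0 and twice the wanted product.\<close>
  have orth: "u s a \<bullet> time_deriv u s a = 0" if s: "s \<ge> 0" and a: "a \<in> nodes T" for s a
  proof -
    have "((\<lambda>r. u r a \<bullet> u r a) has_vector_derivative
        u s a \<bullet> time_deriv u s a + time_deriv u s a \<bullet> u s a) (at s within {0..})"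
      using smooth_curve_time_deriv(3)[OF u s, of a]
      by (intro bounded_bilinear.has_vector_derivative[OF bounded_bilinear_inner])
    moreover have "((\<lambda>r. u r a \<bullet> u r a) has_vector_derivative 0) (at s within {0..})"
      by (rule has_vector_derivative_transform[OF _ _ has_vector_derivative_const[of 1]])
        (use s a unit in auto)
    ultimately have "u s a \<bullet> time_deriv u s a + time_deriv u s a \<bullet> u s a = 0"
      using vector_derivative_unique_within[OF at_within_Ici_neq_bot[OF s]] by blast
    then show ?thesis by (simp add: inner_commute)
  qed
  have energy: "(lumped_norm \<Omega> T (time_deriv u s))\<^sup>2 =
      - \<gamma> * L2_inner \<Omega> (grad (u s)) (grad (time_deriv u s))" if s: "s \<ge> 0" for s
  proof -
    have "nodal_interp \<Omega> T (\<lambda>x. u s x \<bullet> time_deriv u s x) = nodal_interp \<Omega> T (\<lambda>x. 0)"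
      using orth[OF s] by (rule nodal_interp_cong)
    then have "L2_inner \<Omega> (q s) (nodal_interp \<Omega> T (\<lambda>x. u s x \<bullet> time_deriv u s x)) = 0"
      by (simp add: nodal_interp_def L2_inner_def)
    then show ?thesis
      using eq[OF s smooth_curve_time_deriv(2)[OF u s]] R_eq_0[OF s]
      by (simp add: lumped_norm_square)
  qed
  let ?E = "\<lambda>s. L2_inner \<Omega> (grad (u s)) (grad (u s))"
  \<comment> \<open>By \<open>energy\<close>, the scaled Dirichlet energy is an antiderivative of
    the dissipation, so the fundamental theorem of calculus evaluates the integral.\<close>
  have "((\<lambda>s. - (\<gamma> / 2) * ?E s) has_vector_derivative (lumped_norm \<Omega> T (time_deriv u s))\<^sup>2)
      (at s within {0..t})" if s: "s \<in> {0..t}" for s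
  proof -
    have "(?E has_real_derivative 2 * L2_inner \<Omega> (grad (u s)) (grad (time_deriv u s)))
        (at s within {0..})"
      using s by (intro dirichlet_has_derivative smooth_curve_time_deriv[OF u]) auto
    from DERIV_cmult[OF this, of "- (\<gamma> / 2)"]
    have "((\<lambda>s. - (\<gamma> / 2) * ?E s) has_real_derivative (lumped_norm \<Omega> T (time_deriv u s))\<^sup>2)
        (at s within {0..})"
      using energy s by simp
    then show ?thesis
      unfolding has_real_derivative_iff_has_vector_derivative
      by (rule has_vector_derivative_within_subset) auto
  qed
  from fundamental_theorem_of_calculus[OF t this]
  have "integral {0..t} (\<lambda>s. (lumped_norm \<Omega> T (time_deriv u s))\<^sup>2) =
      - (\<gamma> / 2) * ?E t - - (\<gamma> / 2) * ?E 0"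
    by (rule integral_unique)
  moreover have "(L2_norm \<Omega> (grad (u s)))\<^sup>2 = ?E s" for s
    unfolding L2_norm_def by (simp add: L2_inner_def)
  ultimately show "integral {0..t} (\<lambda>s. (lumped_norm \<Omega> T (time_deriv u s))\<^sup>2) +
            \<gamma> / 2 * (L2_norm \<Omega> (grad (u t)))\<^sup>2 = \<gamma> / 2 * (L2_norm \<Omega> (grad (u 0)))\<^sup>2"
    by simp
qed

end

section \<open>The cases of dimension two and three\<close>

lemma vector_mesh_of_family:
  "lipschitz_polytopal_domain \<Omega> \<Longrightarrow> regular_mesh_family \<Omega> H \<T> \<Longrightarrow> h \<in> H \<Longrightarrow> vector_mesh \<Omega> (\<T> h)"
  by unfold_locales (auto simp: lipschitz_polytopal_domain_def regular_mesh_family_def)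

theorem lemma4p5:
  fixes \<gamma> \<alpha> :: real
  assumes "\<gamma> > 0" and "\<alpha> \<ge> 0"
  shows
    "(\<forall>(\<Omega> :: (real^2) set) H \<T> h u0 u0h u q.
        lipschitz_polytopal_domain \<Omega> \<and> regular_mesh_family \<Omega> H \<T> \<and> h \<in> H \<and>
        u0 \<in> H1_vec \<Omega> \<and> (AE x in lebesgue_on \<Omega>. norm (u0 x) = 1) \<and>
        u0h \<in> P1_vec \<Omega> (\<T> h) \<and> (\<forall>a\<in>nodes (\<T> h). norm (u0h a) = 1) \<and>
        L2_norm \<Omega> (grad u0h) \<le> L2_norm \<Omega> (weak_grad \<Omega> u0) \<and>
        smooth_curve (closure \<Omega>) (P1_vec \<Omega> (\<T> h)) u \<and>
        smooth_curve (closure \<Omega>) (P1 \<Omega> (\<T> h)) q \<and>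
        u 0 = u0h \<and>
        (\<forall>t\<ge>0. \<forall>v \<in> P1_vec \<Omega> (\<T> h).
          lumped_inner \<Omega> (\<T> h) (time_deriv u t) v +
          \<gamma> * L2_inner \<Omega> (grad (u t)) (grad v) +
          \<gamma> * L2_inner \<Omega> (q t) (nodal_interp \<Omega> (\<T> h) (\<lambda>x. u t x \<bullet> v x)) = 0) \<and>
        (\<forall>t\<ge>0. \<forall>r \<in> P1 \<Omega> (\<T> h).
          L2_inner \<Omega> (nodal_interp \<Omega> (\<T> h) (\<lambda>x. u t x \<bullet> u t x)) r = L2_inner \<Omega> (\<lambda>x. 1) r)
        \<longrightarrow>
        (\<forall>t\<ge>0.
          (\<forall>a\<in>nodes (\<T> h). norm (u t a) = 1) \<and>
          integral {0..t} (\<lambda>s. (lumped_norm \<Omega> (\<T> h) (time_deriv u s))\<^sup>2) +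
            \<gamma> / 2 * (L2_norm \<Omega> (grad (u t)))\<^sup>2 = \<gamma> / 2 * (L2_norm \<Omega> (grad u0h))\<^sup>2))
     \<and>
     (\<forall>(\<Omega> :: (real^3) set) H \<T> h u0 u0h u q.
        lipschitz_polytopal_domain \<Omega> \<and> regular_mesh_family \<Omega> H \<T> \<and> h \<in> H \<and>
        u0 \<in> H1_vec \<Omega> \<and> (AE x in lebesgue_on \<Omega>. norm (u0 x) = 1) \<and>
        u0h \<in> P1_vec \<Omega> (\<T> h) \<and> (\<forall>a\<in>nodes (\<T> h). norm (u0h a) = 1) \<and>
        L2_norm \<Omega> (grad u0h) \<le> L2_norm \<Omega> (weak_grad \<Omega> u0) \<and>
        smooth_curve (closure \<Omega>) (P1_vec \<Omega> (\<T> h)) u \<and>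
        smooth_curve (closure \<Omega>) (P1 \<Omega> (\<T> h)) q \<and>
        u 0 = u0h \<and>
        (\<forall>t\<ge>0. \<forall>v \<in> P1_vec \<Omega> (\<T> h).
          lumped_inner \<Omega> (\<T> h) (time_deriv u t) v +
          \<gamma> * L2_inner \<Omega> (grad (u t)) (grad v) +
          \<gamma> * L2_inner \<Omega> (q t) (nodal_interp \<Omega> (\<T> h) (\<lambda>x. u t x \<bullet> v x)) +
          \<alpha> * lumped_inner \<Omega> (\<T> h) (\<lambda>x. cross3 (u t x) (time_deriv u t x)) v = 0) \<and>
        (\<forall>t\<ge>0. \<forall>r \<in> P1 \<Omega> (\<T> h).
          L2_inner \<Omega> (nodal_interp \<Omega> (\<T> h) (\<lambda>x. u t x \<bullet> u t x)) r = L2_inner \<Omega> (\<lambda>x. 1) r)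
        \<longrightarrow>
        (\<forall>t\<ge>0.
          (\<forall>a\<in>nodes (\<T> h). norm (u t a) = 1) \<and>
          integral {0..t} (\<lambda>s. (lumped_norm \<Omega> (\<T> h) (time_deriv u s))\<^sup>2) +
            \<gamma> / 2 * (L2_norm \<Omega> (grad (u t)))\<^sup>2 = \<gamma> / 2 * (L2_norm \<Omega> (grad u0h))\<^sup>2))"
proof (intro conjI allI impI; elim conjE)
  fix \<Omega> :: "(real^2) set" and H \<T> h u0 u0h u q and t :: real
  assume "lipschitz_polytopal_domain \<Omega>" "regular_mesh_family \<Omega> H \<T>" "h \<in> H"
  then interpret vector_mesh \<Omega> "\<T> h" by (rule vector_mesh_of_family)
  assume u: "smooth_curve (closure \<Omega>) (P1_vec \<Omega> (\<T> h)) u" and u0: "u 0 = u0h" and t: "0 \<le> t"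
    and eq: "\<forall>t\<ge>0. \<forall>v \<in> P1_vec \<Omega> (\<T> h).
          lumped_inner \<Omega> (\<T> h) (time_deriv u t) v +
          \<gamma> * L2_inner \<Omega> (grad (u t)) (grad v) +
          \<gamma> * L2_inner \<Omega> (q t) (nodal_interp \<Omega> (\<T> h) (\<lambda>x. u t x \<bullet> v x)) = 0"
    and constraint: "\<forall>t\<ge>0. \<forall>r \<in> P1 \<Omega> (\<T> h).
          L2_inner \<Omega> (nodal_interp \<Omega> (\<T> h) (\<lambda>x. u t x \<bullet> u t x)) r = L2_inner \<Omega> (\<lambda>x. 1) r"
  \<comment> \<open>In the plane the additional term is the zero function, and \<open>refl\<close>
    discharges its vanishing.\<close>
  note law = discrete_energy_law[where R = "\<lambda>_ _. 0", OF u _ refl _ t]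
  show "\<forall>a\<in>nodes (\<T> h). norm (u t a) = 1"
    by (rule law(1)) (use eq constraint in auto)
  show "integral {0..t} (\<lambda>s. (lumped_norm \<Omega> (\<T> h) (time_deriv u s))\<^sup>2) +
      \<gamma> / 2 * (L2_norm \<Omega> (grad (u t)))\<^sup>2 = \<gamma> / 2 * (L2_norm \<Omega> (grad u0h))\<^sup>2"
    unfolding u0[symmetric] by (rule law(2)) (use eq constraint in auto)
next
  fix \<Omega> :: "(real^3) set" and H \<T> h u0 u0h u q and t :: real
  assume "lipschitz_polytopal_domain \<Omega>" "regular_mesh_family \<Omega> H \<T>" "h \<in> H"
  then interpret vector_mesh \<Omega> "\<T> h" by (rule vector_mesh_of_family)
  assume u: "smooth_curve (closure \<Omega>) (P1_vec \<Omega> (\<T> h)) u" and u0: "u 0 = u0h" and t: "0 \<le> t"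
    and eq: "\<forall>t\<ge>0. \<forall>v \<in> P1_vec \<Omega> (\<T> h).
          lumped_inner \<Omega> (\<T> h) (time_deriv u t) v +
          \<gamma> * L2_inner \<Omega> (grad (u t)) (grad v) +
          \<gamma> * L2_inner \<Omega> (q t) (nodal_interp \<Omega> (\<T> h) (\<lambda>x. u t x \<bullet> v x)) +
          \<alpha> * lumped_inner \<Omega> (\<T> h) (\<lambda>x. cross3 (u t x) (time_deriv u t x)) v = 0"
    and constraint: "\<forall>t\<ge>0. \<forall>r \<in> P1 \<Omega> (\<T> h).
          L2_inner \<Omega> (nodal_interp \<Omega> (\<T> h) (\<lambda>x. u t x \<bullet> u t x)) r = L2_inner \<Omega> (\<lambda>x. 1) r"
  \<comment> \<open>The cross product is orthogonal to its second factor, here the time derivative,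
    so all nodal values of the integrand are zero.\<close>
  have cross: "\<alpha> * lumped_inner \<Omega> (\<T> h) (\<lambda>x. cross3 (u t x) (time_deriv u t x)) (time_deriv u t) = 0"
    for t
    by (simp add: lumped_inner_eq_0 dot_cross_self)
  note law = discrete_energy_law[where
      R = "\<lambda>t. \<lambda>v. \<alpha> * lumped_inner \<Omega> (\<T> h) (\<lambda>x. cross3 (u t x) (time_deriv u t x)) v",
      OF u _ cross _ t]
  show "\<forall>a\<in>nodes (\<T> h). norm (u t a) = 1"
    by (rule law(1)) (use eq constraint in auto)
  show "integral {0..t} (\<lambda>s. (lumped_norm \<Omega> (\<T> h) (time_deriv u s))\<^sup>2) +
      \<gamma> / 2 * (L2_norm \<Omega> (grad (u t)))\<^sup>2 = \<gamma> / 2 * (L2_norm \<Omega> (grad u0h))\<^sup>2"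
    unfolding u0[symmetric] by (rule law(2)) (use eq constraint in auto)
qed

end
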